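(* Consider the following game. Players stand in a line; the player at the front throws a dart, whose distance to the center is uniform on $[0,1]$ and independent of all other throws. If the distance is strictly smaller than the current distance to beat $x$, the player moves to the back of the line and the distance to beat becomes the distance of this throw; otherwise the player is eliminated. The game ends when one player remains, who is the winner. For $p\ge1$, $1\le k\le p$, $n\ge0$, $x\in[0,1]$, let $R_{n,p,k}(x)$ be the probability that, starting with $p$ players remaining and distance to beat $x$, the $k$th player in the current line wins with exactly $n$ further throws; let $R_{p,k}(x,z)=\sum_{n\ge0}R_{n,p,k}(x)z^n$ and $R_p(x,t,z)=\sum_{k=1}^pR_{p,k}(x,z)t^k$. Then $R_1(x,t,z)=t$, and for $p\ge2$, $$R_p(x,t,z)=\frac{t^{p+1}-t}{p}\sum_{j=0}^{p-1}\frac{\widetilde R_p(x,\zeta_p^j,z)}{t-\zeta_p^j},$$ where $\zeta_p=e^{2\pi i/p}$ and $$\widetilde R_p(x,t,z)=\left(z^{p-1}+tz\int_0^x\frac{\partial}{\partial v}\Big[(1-v)R_{p-1}(v,t,z)\Big]e^{-vtz}\,dv\right)e^{xtz}.$$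
   Context: All quantities are treated as formal power series in $x$ and $z$ with coefficients polynomial in $t$ (or complex numbers after substituting $t=\zeta_p^j$); note $\frac{t^{p+1}-t}{t-\zeta_p^j}$ is a polynomial in $t$. *)

theory Defs
  imports "HOL-Probability.Probability" "HOL-Computational_Algebra.Computational_Algebra"
begin

text \<open>A state of the game is the current line of players (front first) together with the current
  distance to beat.\<close>

fun throw :: "real \<Rightarrow> nat list \<times> real \<Rightarrow> nat list \<times> real" where
  "throw u ([], x) = ([], x)"
| "throw u (a # ps, x) = (if u < x then (ps @ [a], u) else (ps, x))"

primrec run :: "(nat \<Rightarrow> real) \<Rightarrow> nat list \<times> real \<Rightarrow> nat \<Rightarrow> nat list \<times> real" where
  "run d s 0 = s"
| "run d s (Suc n) = throw (d n) (run d s n)"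

text \<open>\<open>run\<close> also continues after the game is over, so the time at which the line first
  consists of one player only has to be singled out.\<close>

definition wins :: "(nat \<Rightarrow> real) \<Rightarrow> nat list \<times> real \<Rightarrow> nat \<Rightarrow> nat \<Rightarrow> bool" where
  "wins d s n k \<longleftrightarrow> fst (run d s n) = [k] \<and> (\<forall>m<n. 1 < length (fst (run d s m)))"

text \<open>\<open>D i\<close> is the distance to the center of the throw number \<open>i\<close>.  The players are
  numbered \<open>1, \<dots>, p\<close> according to their position in the initial line.\<close>

definition R_prob :: "'a measure \<Rightarrow> (nat \<Rightarrow> 'a \<Rightarrow> real) \<Rightarrow> nat \<Rightarrow> nat \<Rightarrow> nat \<Rightarrow> real \<Rightarrow> real" where
  "R_prob M D n p k x =
     measure M {\<omega> \<in> space M. wins (\<lambda>i. D i \<omega>) ([1..<Suc p], x) n k}"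

text \<open>Formal power series are in the variable \<open>z\<close>; polynomials are in the variable \<open>t\<close>.\<close>

definition R_player :: "'a measure \<Rightarrow> (nat \<Rightarrow> 'a \<Rightarrow> real) \<Rightarrow> nat \<Rightarrow> nat \<Rightarrow> real \<Rightarrow> complex fps" where
  "R_player M D p k x = Abs_fps (\<lambda>n. complex_of_real (R_prob M D n p k x))"

definition fps_const_poly :: "complex fps \<Rightarrow> complex poly fps" where
  "fps_const_poly F = Abs_fps (\<lambda>n. [:fps_nth F n:])"

definition fps_eval_poly :: "complex poly fps \<Rightarrow> complex \<Rightarrow> complex fps" where
  "fps_eval_poly F c = Abs_fps (\<lambda>n. poly (fps_nth F n) c)"

definition R_gf :: "'a measure \<Rightarrow> (nat \<Rightarrow> 'a \<Rightarrow> real) \<Rightarrow> nat \<Rightarrow> real \<Rightarrow> complex poly fps" where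
  "R_gf M D p x = (\<Sum>k=1..p. fps_const_poly (R_player M D p k x) * fps_const (monom 1 k))"

text \<open>Differentiation and integration with respect to the real parameter are coefficientwise.
  The parameter ranges over the unit interval, so the derivatives at its end points are
  one-sided.\<close>

definition param_deriv :: "(real \<Rightarrow> complex fps) \<Rightarrow> real \<Rightarrow> complex fps" where
  "param_deriv F v =
     Abs_fps (\<lambda>n. vector_derivative (\<lambda>u. fps_nth (F u) n) (at v within {0..1}))"

definition param_integral :: "real \<Rightarrow> (real \<Rightarrow> complex fps) \<Rightarrow> complex fps" where
  "param_integral x F = Abs_fps (\<lambda>n. integral {0..x} (\<lambda>v. fps_nth (F v) n))"

text \<open>\<open>fps_exp c\<close> is the power series of \<open>exp (c z)\<close>.\<close>

definition R_tilde ::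
  "'a measure \<Rightarrow> (nat \<Rightarrow> 'a \<Rightarrow> real) \<Rightarrow> nat \<Rightarrow> real \<Rightarrow> complex \<Rightarrow> complex fps" where
  "R_tilde M D p x t =
     (fps_X ^ (p - 1) + fps_const t * fps_X *
        param_integral x (\<lambda>v.
          param_deriv (\<lambda>u. fps_const (of_real (1 - u)) * fps_eval_poly (R_gf M D (p - 1) u) t) v
          * fps_exp (- of_real v * t)))
     * fps_exp (of_real x * t)"

definition zeta :: "nat \<Rightarrow> complex" where
  "zeta p = exp (2 * of_real pi * \<i> / of_nat p)"

definition kernel_poly :: "nat \<Rightarrow> nat \<Rightarrow> complex poly" where
  "kernel_poly p j = (monom 1 (p + 1) - monom 1 1) div [:- (zeta p ^ j), 1:]"

text \<open>The division is exact.\<close>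

lemma kernel_poly_mult:
  assumes "p \<ge> 1"
  shows "kernel_poly p j * [:- (zeta p ^ j), 1:] = monom 1 (p + 1) - monom 1 1"
proof -
  have "zeta p ^ p = exp (of_nat p * (2 * of_real pi * \<i> / of_nat p))"
    unfolding zeta_def by (rule exp_of_nat_mult [symmetric])
  also have "of_nat p * (2 * of_real pi * \<i> / of_nat p) = 2 * of_real pi * \<i>"
    using assms by simp
  finally have "zeta p ^ p = 1"
    by simp
  then have "(zeta p ^ j) ^ p = 1"
    by (metis power_commutes power_mult mult.commute power_one)
  then have "poly (monom 1 (p + 1) - monom 1 1) (zeta p ^ j) = 0"
    by (simp add: poly_monom)
  then show ?thesis
    unfolding kernel_poly_def poly_eq_0_iff_dvd by (rule dvd_div_mult_self)
qed

end

theory Submission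
  imports Defs
begin

text \<open>Conditioning on the first throw gives, for \<open>p \<ge> 2\<close>,
  \<open>R\<^sub>n\<^sub>+\<^sub>1\<^sub>,\<^sub>p\<^sub>,\<^sub>k\<^sub>+\<^sub>1(x) = \<integral>\<^sub>0\<^sup>x R\<^sub>n\<^sub>,\<^sub>p\<^sub>,\<^sub>k(u) du + (1 - x) R\<^sub>n\<^sub>,\<^sub>p\<^sub>-\<^sub>1\<^sub>,\<^sub>k(x)\<close>, where the indices
  of the integrand are read cyclically because a successful front player moves to the back.
  When \<open>t\<close> is a \<open>p\<close>-th root of unity the cyclic shift is multiplication by \<open>t\<close>, so
  \<open>F(x) = R\<^sub>p(x, t, z)\<close> satisfies \<open>F(x) = t z (\<integral>\<^sub>0\<^sup>x F(u) du + (1 - x) R\<^sub>p\<^sub>-\<^sub>1(x, t, z))\<close> with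
  \<open>F(0) = z\<^bsup>p - 1\<^esup>\<close>. Solving this linear equation with the integrating factor \<open>e\<^bsup>-x t z\<^esup>\<close> identifies
  \<open>F(x)\<close> with the modified series at \<open>t\<close>. Finally \<open>R\<^sub>p\<close> has degree at most \<open>p\<close> in \<open>t\<close> and vanishes
  at \<open>t = 0\<close>, so it is recovered by Lagrange interpolation at \<open>0\<close> and the \<open>p\<close>-th roots of unity.\<close>

unbundle no vec_syntax

section \<open>The first throw\<close>

text \<open>\<open>run\<close> appends throws at the end, whereas conditioning on the first throw
  needs the recursion peeled off at the front.\<close>

lemma run_Suc_first: "run d s (Suc n) = run (\<lambda>i. d (Suc i)) (throw (d 0) s) n"
  by (induction n) auto

lemma wins_Suc:
  "wins d s (Suc n) k \<longleftrightarrow>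
     1 < length (fst s) \<and> wins (\<lambda>i. d (Suc i)) (throw (d 0) s) n k"
  unfolding wins_def All_less_Suc2 run_Suc_first by (auto simp del: run.simps(2))

lemma set_throw: "set (fst (throw u s)) \<subseteq> set (fst s)"
  by (cases "(u, s)" rule: throw.cases) auto

lemma set_run: "set (fst (run d s n)) \<subseteq> set (fst s)"
  by (induction n) (use set_throw in fastforce)+

lemma run_map: "run d (map g ps, x) n = apfst (map g) (run d (ps, x) n)"
proof (induction n)
  case (Suc n)
  have "throw u (apfst (map g) s) = apfst (map g) (throw u s)" for u s
    by (cases "(u, s)" rule: throw.cases) auto
  with Suc show ?case by simp
qed simp

text \<open>The rules never inspect the names of the players. Injectivity also covers
  \<open>k\<close>, so that \<open>[g k]\<close> cannot arise from a different sole
  survivor.\<close>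

lemma wins_map:
  assumes "inj_on g (insert k (set ps))"
  shows "wins d (map g ps, x) n (g k) \<longleftrightarrow> wins d (ps, x) n k"
proof -
  have "map g l = [g k] \<longleftrightarrow> l = [k]" if "set l \<subseteq> set ps" for l
    using that assms by (auto simp: map_eq_Cons_conv inj_on_def)
  then show ?thesis
    using set_run[of d "(ps, x)" n] by (simp add: wins_def run_map)
qed

lemma wins_imp_mem: "wins d (ps, x) n k \<Longrightarrow> k \<in> set ps"
  using set_run[of d "(ps, x)" n] by (auto simp: wins_def)

section \<open>The law of the sequence of throws and measurability of the game\<close>

definition unif :: "real measure" where
  "unif = uniform_measure lborel {0..1}"

lemma sets_unif [simp, measurable_cong]: "sets unif = sets borel"
  by (simp add: unif_def)

lemma space_unif [simp]: "space unif = UNIV"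
  by (simp add: unif_def)

lemma prob_space_unif: "prob_space unif"
  unfolding unif_def by (rule prob_space_uniform_measure) auto

interpretation unif: prob_space unif
  by (rule prob_space_unif)

interpretation throws: sequence_space unif
  by unfold_locales

abbreviation throws :: "(nat \<Rightarrow> real) measure" where
  "throws \<equiv> Pi\<^sub>M UNIV (\<lambda>_. unif)"

lemma space_throws [simp]: "space throws = UNIV"
  by (simp add: space_PiM)

text \<open>Lines of players form a countable type, so it suffices to treat each fixed line
  separately.\<close>

lemma measurable_throw [measurable (raw)]:
  assumes [measurable]: "f \<in> borel_measurable N"
    "g \<in> N \<rightarrow>\<^sub>M count_space UNIV \<Otimes>\<^sub>M borel"
  shows "(\<lambda>w. throw (f w) (g w)) \<in> N \<rightarrow>\<^sub>M count_space UNIV \<Otimes>\<^sub>M borel"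
proof -
  have "(\<lambda>w. throw (f w) (ps, snd (g w))) \<in> N \<rightarrow>\<^sub>M count_space UNIV \<Otimes>\<^sub>M borel" for ps
    by (cases ps) auto
  then have "(\<lambda>w. throw (f w) (fst (g w), snd (g w))) \<in> N \<rightarrow>\<^sub>M count_space UNIV \<Otimes>\<^sub>M borel"
    by (rule measurable_compose_countable) measurable
  then show ?thesis by simp
qed

lemma measurable_run [measurable (raw)]:
  assumes [measurable]: "\<And>i. (\<lambda>w. d w i) \<in> borel_measurable N"
    "s \<in> N \<rightarrow>\<^sub>M count_space UNIV \<Otimes>\<^sub>M borel"
  shows "(\<lambda>w. run (d w) (s w) n) \<in> N \<rightarrow>\<^sub>M count_space UNIV \<Otimes>\<^sub>M borel"
  by (induction n) auto

lemma measurable_wins [measurable (raw)]: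
  assumes [measurable]: "\<And>i. (\<lambda>w. d w i) \<in> borel_measurable N"
    "s \<in> N \<rightarrow>\<^sub>M count_space UNIV \<Otimes>\<^sub>M borel"
  shows "Measurable.pred N (\<lambda>w. wins (d w) (s w) n k)"
  unfolding wins_def by measurable

section \<open>Winning probabilities under the product law\<close>

definition win_prob :: "nat \<Rightarrow> nat list \<times> real \<Rightarrow> nat \<Rightarrow> real" where
  "win_prob n s k = measure throws {d. wins d s n k}"

lemma win_prob_nonneg: "0 \<le> win_prob n s k"
  by (simp add: win_prob_def)

text \<open>Independence and the common uniform law make the joint distribution of the throws the
  product measure. The abstract space can thus be replaced by sequence space, where shifting the
  throws preserves the measure.\<close>

lemma R_prob_eq_win_prob:
  assumes "prob_space M" "prob_space.indep_vars M (\<lambda>_. borel) D UNIV"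
    "\<And>i. distr M borel (D i) = uniform_measure lborel {0..1}"
  shows "R_prob M D n p k x = win_prob n ([1..<Suc p], x) k"
proof -
  interpret prob_space M by fact
  have [measurable]: "D i \<in> borel_measurable M" for i
    using assms(2) by (auto simp: indep_vars_def)
  have [measurable]: "(\<lambda>\<omega> i. D i \<omega>) \<in> M \<rightarrow>\<^sub>M (\<Pi>\<^sub>M i\<in>UNIV. borel)"
    by (rule measurable_PiM_single') auto
  have "distr M (\<Pi>\<^sub>M i\<in>UNIV. borel) (\<lambda>\<omega>. \<lambda>i\<in>UNIV. D i \<omega>) = throws"
    using assms(2,3) indep_vars_iff_distr_eq_PiM'[where I = UNIV and M' = "\<lambda>_. borel" and X = D]
    by (simp add: unif_def)
  moreover have "{d. wins d ([1..<Suc p], x) n k} \<in> sets (\<Pi>\<^sub>M i\<in>(UNIV :: nat set). borel :: real measure)"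
  proof -
    have "Measurable.pred (\<Pi>\<^sub>M i\<in>(UNIV :: nat set). borel :: real measure)
        (\<lambda>d. wins d ([1..<Suc p], x) n k)"
      by measurable
    then show ?thesis by (simp add: pred_def space_PiM)
  qed
  ultimately have "win_prob n ([1..<Suc p], x) k =
      prob ((\<lambda>\<omega> i. D i \<omega>) -` {d. wins d ([1..<Suc p], x) n k} \<inter> space M)"
    unfolding win_prob_def by (subst measure_distr[symmetric]) (auto simp: restrict_UNIV)
  then show ?thesis
    by (simp add: R_prob_def vimage_def Int_def conj_commute)
qed

lemma win_prob_0: "win_prob 0 (ps, x) k = (if ps = [k] then 1 else 0)"
  using prob_space.prob_space[OF prob_space_PiM[where M = "\<lambda>_. unif" and I = "UNIV :: nat set", OF prob_space_unif]]
  by (cases "ps = [k]") (simp_all add: win_prob_def wins_def)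

lemma win_prob_Suc_game_over: "length ps \<le> 1 \<Longrightarrow> win_prob (Suc n) (ps, x) k = 0"
  by (simp add: win_prob_def wins_Suc)

lemma win_prob_not_mem: "k \<notin> set ps \<Longrightarrow> win_prob n (ps, x) k = 0"
  using wins_imp_mem by (metis (mono_tags, lifting) empty_Collect_eq measure_empty win_prob_def)

lemma win_prob_map:
  "inj_on g (insert k (set ps)) \<Longrightarrow> win_prob n (map g ps, x) (g k) = win_prob n (ps, x) k"
  by (simp add: win_prob_def wins_map)

text \<open>Prepending an independent uniform value to a random sequence reproduces the product law.
  The measure of the winning event is then the integral of its sections over the first
  throw.\<close>

lemma win_prob_first_throw:
  assumes "1 < length (fst s)"
  shows "ennreal (win_prob (Suc n) s k) = (\<integral>\<^sup>+u. ennreal (win_prob n (throw u s) k) \<partial>unif)"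
proof -
  let ?A = "{d. wins d s (Suc n) k}" and ?f = "\<lambda>(u, d). case_nat u d :: nat \<Rightarrow> real"
  let ?X = "?f -` ?A \<inter> space (unif \<Otimes>\<^sub>M throws)"
  have [measurable]: "s \<in> space (count_space UNIV \<Otimes>\<^sub>M borel)"
    by (simp add: space_pair_measure)
  have "Measurable.pred throws (\<lambda>d. wins d s (Suc n) k)"
    by measurable
  then have A: "?A \<in> sets throws"
    by (simp add: pred_def)
  have f: "?f \<in> unif \<Otimes>\<^sub>M throws \<rightarrow>\<^sub>M throws"
    by measurable
  have "ennreal (win_prob (Suc n) s k) = emeasure (distr (unif \<Otimes>\<^sub>M throws) throws ?f) ?A"
    unfolding win_prob_def throws.PiM_iter by (simp add: throws.emeasure_eq_measure)
  also have "\<dots> = emeasure (unif \<Otimes>\<^sub>M throws) ?X"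
    by (rule emeasure_distr[OF f A])
  also have "\<dots> = (\<integral>\<^sup>+u. emeasure throws (Pair u -` ?X) \<partial>unif)"
    by (rule throws.emeasure_pair_measure_alt[OF measurable_sets[OF f A]])
  also have "\<dots> = (\<integral>\<^sup>+u. ennreal (win_prob n (throw u s) k) \<partial>unif)"
    using assms
    by (simp add: win_prob_def throws.emeasure_eq_measure wins_Suc vimage_def space_pair_measure)
  finally show ?thesis .
qed

text \<open>A throw \<open>u < x\<close> contributes the integral of a polynomial, evaluated through
  \<open>Q\<close>; the remaining throws have total length \<open>1 - x\<close> and leave
  \<open>x\<close> unchanged. Assuming an antiderivative makes the lemma usable inside the induction
  that proves polynomiality.\<close>

lemma win_prob_Suc_antiderivative:
  assumes Q: "\<And>u. u \<in> {0..1} \<Longrightarrow> win_prob n (qs @ [a], u) k = poly (pderiv Q) u"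
    and "qs \<noteq> []" "0 \<le> x" "x \<le> 1"
  shows "win_prob (Suc n) (a # qs, x) k = poly Q x - poly Q 0 + (1 - x) * win_prob n (qs, x) k"
proof -
  let ?c = "win_prob n (qs, x) k"
  have nonneg: "poly (pderiv Q) u \<ge> 0" if "u \<in> {0..1}" for u
    using Q[OF that] win_prob_nonneg by metis
  have [measurable]: "poly (pderiv Q) \<in> borel_measurable borel"
    by (intro borel_measurable_continuous_onI continuous_intros)
  have *: "(\<integral>\<^sup>+u. ennreal (poly (pderiv Q) u) * indicator {0..x} u \<partial>lborel)
      = ennreal (poly Q x - poly Q 0)"
    using assms nonneg by (intro nn_integral_FTC_Icc) (auto intro!: poly_DERIV)
  have mono: "poly Q x - poly Q 0 \<ge> 0"
  proof -
    have "poly Q 0 \<le> poly Q x"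
      by (rule DERIV_nonneg_imp_nondecreasing[OF \<open>0 \<le> x\<close>])
         (use nonneg assms in \<open>force intro: poly_DERIV\<close>)
    then show ?thesis by simp
  qed
  have "ennreal (win_prob (Suc n) (a # qs, x) k) =
      (\<integral>\<^sup>+u. ennreal (win_prob n (throw u (a # qs, x)) k) \<partial>unif)"
    using assms by (intro win_prob_first_throw) (cases qs, auto)
  also have "\<dots> = (\<integral>\<^sup>+u. ennreal (if u < x then poly (pderiv Q) u else ?c) \<partial>unif)"
    unfolding unif_def
    by (intro nn_integral_cong_AE AE_uniform_measureI) (use assms in auto)
  also have "\<dots> = (\<integral>\<^sup>+u. ennreal (if u < x then poly (pderiv Q) u else ?c) * indicator {0..1} u \<partial>lborel)"
    unfolding unif_def by (subst nn_integral_uniform_measure) (auto simp: divide_ennreal_def)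
  also have "\<dots> = (\<integral>\<^sup>+u. ennreal (poly (pderiv Q) u) * indicator {0..x} u
      + ennreal ?c * indicator {x..1} u \<partial>lborel)"
    \<comment> \<open>The two indicators overlap at \<open>u = x\<close> only, which is a null
      set.\<close>
    by (rule nn_integral_cong_AE, use AE_lborel_singleton[of x] in eventually_elim)
       (use assms in \<open>auto simp: indicator_def\<close>)
  also have "\<dots> = ennreal (poly Q x - poly Q 0) + ennreal ?c * ennreal (1 - x)"
    using assms by (subst nn_integral_add) (auto simp: * nn_integral_cmult_indicator)
  also have "\<dots> = ennreal (poly Q x - poly Q 0 + (1 - x) * ?c)"
    using mono assms win_prob_nonneg[of n "(qs, x)" k]
    by (simp add: ennreal_mult' [symmetric] ennreal_plus[symmetric] mult.commute del: ennreal_plus)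
  finally show ?thesis
    using mono assms win_prob_nonneg by (subst (asm) ennreal_inj) auto
qed

lemma pderiv_sum: "pderiv (sum f A) = (\<Sum>x\<in>A. pderiv (f x))"
  using higher_pderiv_sum[of 1] by simp

lemma exists_antiderivative_poly:
  fixes q :: "'a :: field_char_0 poly"
  shows "\<exists>Q. pderiv Q = q"
proof -
  have "pderiv (\<Sum>i\<le>degree q. monom (coeff q i / of_nat (Suc i)) (Suc i)) = q"
    by (simp add: pderiv_sum pderiv_monom poly_as_sum_of_monoms del: of_nat_Suc)
  then show ?thesis ..
qed

text \<open>Integrating over \<open>{0..x}\<close> and multiplying by \<open>1 - x\<close> both
  preserve polynomials. This is the source of all integrability and differentiability in
  \<open>x\<close> below.\<close>

lemma win_prob_poly: "\<exists>q. \<forall>x\<in>{0..1}. win_prob n (ps, x) k = poly q x"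
proof (induction n arbitrary: ps)
  case 0
  show ?case by (intro exI[of _ "if ps = [k] then 1 else 0"]) (simp add: win_prob_0)
next
  case (Suc n)
  show ?case
  proof (cases "length ps \<le> 1")
    case True
    then show ?thesis by (intro exI[of _ 0]) (simp add: win_prob_Suc_game_over)
  next
    case False
    then obtain a qs where ps: "ps = a # qs" "qs \<noteq> []"
      by (cases ps) auto
    obtain q q' where "\<forall>u\<in>{0..1}. win_prob n (qs @ [a], u) k = poly q u"
      and q': "\<forall>u\<in>{0..1}. win_prob n (qs, u) k = poly q' u"
      using Suc.IH by meson
    moreover obtain Q where "pderiv Q = q"
      using exists_antiderivative_poly by blast
    ultimately show ?thesis
      using ps win_prob_Suc_antiderivative[of n qs a k Q]
      by (intro exI[of _ "Q - [:poly Q 0:] + [:1, -1:] * q'"]) (simp add: algebra_simps)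
  qed
qed

lemma win_prob_Suc:
  assumes "qs \<noteq> []" "0 \<le> x" "x \<le> 1"
  shows "win_prob (Suc n) (a # qs, x) k =
    integral {0..x} (\<lambda>u. win_prob n (qs @ [a], u) k) + (1 - x) * win_prob n (qs, x) k"
proof -
  obtain q where q: "\<forall>u\<in>{0..1}. win_prob n (qs @ [a], u) k = poly q u"
    using win_prob_poly by blast
  obtain Q where Q: "pderiv Q = q"
    using exists_antiderivative_poly by blast
  have "(poly q has_integral poly Q x - poly Q 0) {0..x}"
    using assms Q by (intro fundamental_theorem_of_calculus)
      (auto simp: has_real_derivative_iff_has_vector_derivative[symmetric]
            intro!: poly_DERIV has_field_derivative_at_within)
  then have "((\<lambda>u. win_prob n (qs @ [a], u) k) has_integral poly Q x - poly Q 0) {0..x}"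
    by (rule has_integral_eq[rotated]) (use q assms in auto)
  then show ?thesis
    using win_prob_Suc_antiderivative[of n qs a k Q x] q Q assms by (simp add: integral_unique)
qed

section \<open>The recursion for the winning probabilities\<close>

definition player_prob :: "nat \<Rightarrow> nat \<Rightarrow> nat \<Rightarrow> real \<Rightarrow> real" where
  "player_prob n p k = (\<lambda>x. win_prob n ([1..<Suc p], x) k)"

lemma player_prob_0: "p \<ge> 2 \<Longrightarrow> player_prob 0 p k x = 0"
  by (simp add: player_prob_def win_prob_0 upt_conv_Cons)

text \<open>After a successful throw, place \<open>k < p\<close> is held by the former player
  \<open>k + 1\<close> and place \<open>p\<close> by the former front player. The proof relabels the
  line by this cyclic shift.\<close>

lemma player_prob_rotate:
  assumes "1 \<le> k" "k \<le> p"
  shows "win_prob n ([2..<Suc p] @ [1], u) (if k = p then 1 else Suc k) = player_prob n p k u"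
proof -
  let ?g = "\<lambda>i. if i = p then 1 else Suc i"
  have "map ?g [1..<Suc p] = map ?g [1..<p] @ [1]"
    using assms by simp
  also have "map ?g [1..<p] = map Suc [1..<p]"
    by (rule map_cong) auto
  finally have "map ?g [1..<Suc p] = [2..<Suc p] @ [1]"
    by (simp add: map_Suc_upt numeral_2_eq_2)
  moreover have "inj_on ?g (insert k (set [1..<Suc p]))"
    using assms by (auto simp: inj_on_def)
  ultimately show ?thesis
    using win_prob_map[of ?g k "[1..<Suc p]" n u] by (simp add: player_prob_def)
qed

lemma player_prob_drop_first: "win_prob n ([2..<Suc p], u) (Suc k) = player_prob n (p - 1) k u"
proof (cases p)
  case (Suc q)
  then show ?thesis
    using win_prob_map[OF inj_Suc, where k = k and ps = "[1..<Suc q]" and n = n and x = u]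
    by (simp add: player_prob_def map_Suc_upt numeral_2_eq_2 del: upt_Suc)
qed (simp add: player_prob_def win_prob_not_mem)

text \<open>There is no elimination term: the front player survives only by a successful throw, and
  then stands at place \<open>p\<close>.\<close>

lemma player_prob_Suc_1:
  assumes "p \<ge> 2" "0 \<le> x" "x \<le> 1"
  shows "player_prob (Suc n) p 1 x = integral {0..x} (player_prob n p p)"
proof -
  have "[1..<Suc p] = 1 # [2..<Suc p]" "[2..<Suc p] \<noteq> []"
    using assms by (simp_all add: upt_conv_Cons numeral_2_eq_2)
  then show ?thesis
    using win_prob_Suc[of "[2..<Suc p]" x n 1 1] player_prob_rotate[of p p n] assms
    by (simp add: player_prob_def win_prob_not_mem del: upt_Suc)
qed

lemma player_prob_Suc_Suc:
  assumes "1 \<le> k" "k < p" "0 \<le> x" "x \<le> 1"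
  shows "player_prob (Suc n) p (Suc k) x =
    integral {0..x} (player_prob n p k) + (1 - x) * player_prob n (p - 1) k x"
proof -
  have "[1..<Suc p] = 1 # [2..<Suc p]" "[2..<Suc p] \<noteq> []"
    using assms by (simp_all add: upt_conv_Cons numeral_2_eq_2)
  then show ?thesis
    using win_prob_Suc[of "[2..<Suc p]" x n 1 "Suc k"] player_prob_rotate[of k p n]
      player_prob_drop_first[of n p x k] assms
    by (simp add: player_prob_def del: upt_Suc)
qed

lemma player_prob_differentiable:
  assumes "v \<in> {0..1}"
  shows "player_prob n p k differentiable (at v within {0..1})"
proof -
  obtain q where q: "\<forall>x\<in>{0..1}. player_prob n p k x = poly q x"
    unfolding player_prob_def using win_prob_poly by blast
  have "poly q differentiable (at v within {0..1})"
    using poly_differentiable by (rule differentiable_at_withinI)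
  then show ?thesis
    by (rule differentiable_transform_within[of _ _ _ 1]) (use q assms in auto)
qed

text \<open>This is the coefficient of \<open>z^n\<close> in \<open>R_p(x, t, z)\<close> with a
  complex number substituted for \<open>t\<close>.\<close>

definition player_gf :: "nat \<Rightarrow> nat \<Rightarrow> complex \<Rightarrow> real \<Rightarrow> complex" where
  "player_gf n p t x = (\<Sum>k=1..p. of_real (player_prob n p k x) * t ^ k)"

lemma player_gf_differentiable:
  assumes "v \<in> {0..1}"
  shows "player_gf n p t differentiable (at v within {0..1})"
proof -
  have "(\<lambda>x. complex_of_real (player_prob n p k x)) differentiable (at v within {0..1})" for k
    using player_prob_differentiable[OF assms, of n p k] unfolding differentiable_def
    by (blast intro: has_derivative_of_real)
  then show ?thesis
    unfolding player_gf_def by (intro derivative_intros ballI) auto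
qed

lemma continuous_on_player_gf: "continuous_on {0..1} (player_gf n p t)"
  by (intro differentiable_imp_continuous_on) (simp add: differentiable_on_def player_gf_differentiable)

lemma integral_player_gf:
  assumes "x \<in> {0..1}"
  shows "integral {0..x} (player_gf n p t) =
    (\<Sum>k=1..p. of_real (integral {0..x} (player_prob n p k)) * t ^ k)"
proof -
  have int: "player_prob n p k integrable_on {0..x}" for k
  proof (rule integrable_continuous_real)
    have "continuous_on {0..1} (player_prob n p k)"
      by (intro differentiable_imp_continuous_on)
        (simp add: differentiable_on_def player_prob_differentiable)
    then show "continuous_on {0..x} (player_prob n p k)"
      using assms by (auto elim: continuous_on_subset)
  qed
  have "(player_gf n p t has_integral
      (\<Sum>k=1..p. of_real (integral {0..x} (player_prob n p k)) * t ^ k)) {0..x}"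
    unfolding player_gf_def
    by (intro has_integral_sum has_integral_mult_left has_integral_of_real integrable_integral int) auto
  then show ?thesis by (rule integral_unique)
qed

lemma player_gf_0: "p \<ge> 2 \<Longrightarrow> player_gf 0 p t x = 0"
  by (simp add: player_gf_def player_prob_0)

text \<open>The last summand corrects for the front player, who moves to position \<open>p\<close> and not to
  position \<open>0\<close>; it disappears at the \<open>p\<close>-th roots of unity.\<close>

lemma player_gf_Suc:
  assumes "p \<ge> 2" "x \<in> {0..1}"
  shows "player_gf (Suc n) p t x =
    t * (integral {0..x} (player_gf n p t) + of_real (1 - x) * player_gf n (p - 1) t x)
    + (1 - t ^ p) * t * of_real (integral {0..x} (player_prob n p p))"
proof -
  let ?I = "\<lambda>k. of_real (integral {0..x} (player_prob n p k)) :: complex"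
  obtain q where p: "p = Suc q" "q \<ge> 1"
    using assms by (cases p) auto
  have "player_gf (Suc n) p t x = of_real (player_prob (Suc n) p 1 x) * t
      + (\<Sum>k=1..q. of_real (player_prob (Suc n) p (Suc k) x) * t ^ Suc k)"
    unfolding player_gf_def p
    by (subst sum.atLeast_Suc_atMost)
       (simp_all add: sum.shift_bounds_cl_Suc_ivl del: sum.cl_ivl_Suc)
  also have "player_prob (Suc n) p 1 x = integral {0..x} (player_prob n p p)"
    using assms by (intro player_prob_Suc_1) auto
  also have "(\<Sum>k=1..q. of_real (player_prob (Suc n) p (Suc k) x) * t ^ Suc k) =
      (\<Sum>k=1..q. t * (?I k * t ^ k) + t * (of_real (1 - x) * (of_real (player_prob n q k x) * t ^ k)))"
    using assms p by (intro sum.cong refl) (simp add: player_prob_Suc_Suc algebra_simps)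
  also have "\<dots> = t * (\<Sum>k=1..q. ?I k * t ^ k) + t * (of_real (1 - x) * player_gf n q t x)"
    by (simp add: player_gf_def sum.distrib sum_distrib_left)
  \<comment> \<open>Completing the sum to \<open>k = p\<close> costs \<open>?I p * t ^ p\<close>;
    after multiplication by \<open>t\<close> this combines with the front player's term
    \<open>?I p * t\<close> into the correction.\<close>
  also have "(\<Sum>k=1..q. ?I k * t ^ k) = integral {0..x} (player_gf n p t) - ?I p * t ^ p"
    using assms p by (simp add: integral_player_gf)
  finally show ?thesis
    using p by (simp add: algebra_simps)
qed

lemma player_gf_singleton: "player_gf n 1 t x = (if n = 0 then t else 0)"
  by (cases n) (simp_all add: player_gf_def player_prob_def win_prob_0 win_prob_Suc_game_over)

text \<open>At distance 0 the integrals vanish and each throw eliminates the front player, so the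
  last player wins after \<open>p - 1\<close> throws.\<close>

lemma player_gf_at_0: "p \<ge> 1 \<Longrightarrow> player_gf n p t 0 = (if Suc n = p then t ^ p else 0)"
proof (induction p arbitrary: n rule: nat_induct_at_least)
  case base
  then show ?case by (simp add: player_gf_singleton[unfolded One_nat_def])
next
  case (Suc p)
  then show ?case
    by (cases n) (simp_all add: player_gf_0 player_gf_Suc)
qed

section \<open>A linear integral equation for power series\<close>

text \<open>A relation is used because \<open>param_deriv\<close> alone does not assert
  differentiability; the calculus rules can then be lifted coefficientwise.\<close>

definition has_param_derivative :: "(real \<Rightarrow> complex fps) \<Rightarrow> complex fps \<Rightarrow> real \<Rightarrow> bool" where
  "has_param_derivative F F' v \<longleftrightarrow>
     (\<forall>n. ((\<lambda>u. F u $ n) has_vector_derivative F' $ n) (at v within {0..1}))"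

lemma param_deriv_eqI:
  assumes "has_param_derivative F F' v" "v \<in> {0..1}"
  shows "param_deriv F v = F'"
  using assms
  by (intro fps_ext)
     (auto simp: param_deriv_def has_param_derivative_def
       intro!: vector_derivative_within_closed_interval)

text \<open>Each coefficient of a product is a finite Cauchy sum, so the ordinary Leibniz rule
  applies term by term.\<close>

lemma has_param_derivative_mult:
  assumes "has_param_derivative F F' v" "has_param_derivative G G' v"
  shows "has_param_derivative (\<lambda>u. F u * G u) (F v * G' + F' * G v) v"
  unfolding has_param_derivative_def fps_mult_nth fps_add_nth sum.distrib[symmetric]
  using assms
  by (intro allI has_vector_derivative_sum has_vector_derivative_mult)
     (auto simp: has_param_derivative_def)

lemma has_param_derivative_add:
  assumes "has_param_derivative F F' v" "has_param_derivative G G' v"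
  shows "has_param_derivative (\<lambda>u. F u + G u) (F' + G') v"
  using assms by (auto simp: has_param_derivative_def intro!: has_vector_derivative_add)

lemma has_param_derivative_const: "has_param_derivative (\<lambda>u. F) 0 v"
  by (simp add: has_param_derivative_def)

lemma has_param_derivative_exp:
  "has_param_derivative (\<lambda>u. fps_exp (of_real u * c))
     (fps_const c * fps_X * fps_exp (of_real v * c)) v"
  unfolding has_param_derivative_def
proof
  fix n
  show "((\<lambda>u. fps_exp (of_real u * c) $ n) has_vector_derivative
      (fps_const c * fps_X * fps_exp (of_real v * c)) $ n) (at v within {0..1})"
  proof (cases n)
    case (Suc m)
    have "((\<lambda>u. (u * c) ^ Suc m) has_field_derivative
        of_nat (Suc m) * c * (of_real v * c) ^ m) (at (of_real v))"
      by (rule derivative_eq_intros refl)+ simp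
    \<comment> \<open>The complex derivative at a real point is restricted to the real line.\<close>
    from has_vector_derivative_real_field[OF DERIV_cdivide[OF this, of "fact (Suc m)"]]
    have "((\<lambda>u. (of_real u * c) ^ Suc m / fact (Suc m)) has_vector_derivative
        of_nat (Suc m) * c * (of_real v * c) ^ m / fact (Suc m)) (at v within {0..1})" .
    also have "of_nat (Suc m) * c * (of_real v * c) ^ m / fact (Suc m) =
        c * ((of_real v * c) ^ m / fact m)"
      by (simp del: of_nat_Suc)
    finally show ?thesis
      by (simp add: Suc mult.assoc del: power_Suc fact_Suc)
  qed simp
qed

lemma has_param_derivative_integral:
  assumes "\<And>n. continuous_on {0..1} (\<lambda>v. F v $ n)" "v \<in> {0..1}"
  shows "has_param_derivative (\<lambda>u. param_integral u F) (F v) v"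
  using assms
  by (auto simp: has_param_derivative_def param_integral_def intro!: integral_has_vector_derivative)

lemma param_integral_derivative:
  assumes "\<And>v. v \<in> {0..1} \<Longrightarrow> has_param_derivative F (F' v) v" "x \<in> {0..1}"
  shows "param_integral x F' = F x - F 0"
proof (rule fps_ext)
  fix n
  have "((\<lambda>v. F' v $ n) has_integral (F x $ n - F 0 $ n)) {0..x}"
    using assms
    by (intro fundamental_theorem_of_calculus)
       (fastforce simp: has_param_derivative_def intro: has_vector_derivative_within_subset)+
  then show "param_integral x F' $ n = (F x - F 0) $ n"
    by (simp add: param_integral_def integral_unique)
qed

lemma param_integral_fps_const_X:
  "param_integral x (\<lambda>v. fps_const c * fps_X * F v) = fps_const c * fps_X * param_integral x F"
  by (rule fps_ext) (simp add: param_integral_def mult.assoc)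

lemma param_integral_cong:
  assumes "\<And>v. v \<in> {0..x} \<Longrightarrow> F v = G v"
  shows "param_integral x F = param_integral x G"
  unfolding param_integral_def using assms by (intro arg_cong[of _ _ Abs_fps] ext integral_cong) simp

text \<open>Differentiating the equation gives \<open>F' = c z (F + B')\<close>. The integrating
  factor \<open>e^(-v c z)\<close> removes the term with \<open>F\<close>, and integration from 0 to
  \<open>x\<close> yields the formula.\<close>

lemma param_integral_equation_solution:
  assumes F: "\<And>v. v \<in> {0..1} \<Longrightarrow> F v = fps_const c * fps_X * (param_integral v F + B v)"
    and cont: "\<And>n. continuous_on {0..1} (\<lambda>v. F v $ n)"
    and B: "\<And>v. v \<in> {0..1} \<Longrightarrow> has_param_derivative B (B' v) v"
    and x: "x \<in> {0..1}"
  shows "F x = (F 0 + fps_const c * fps_X *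
      param_integral x (\<lambda>v. param_deriv B v * fps_exp (- of_real v * c))) * fps_exp (of_real x * c)"
proof -
  let ?e = "\<lambda>v. fps_exp (of_real v * - c)" and ?z = "fps_const c * fps_X"
  have F': "has_param_derivative F (?z * (F v + B' v)) v" if "v \<in> {0..1}" for v
  proof -
    have "has_param_derivative (\<lambda>v. ?z * (param_integral v F + B v))
        (?z * (F v + B' v) + 0 * (param_integral v F + B v)) v"
      by (intro has_param_derivative_mult has_param_derivative_const has_param_derivative_add
          has_param_derivative_integral cont B that)
    then have deriv: "((\<lambda>v. (?z * (param_integral v F + B v)) $ n) has_vector_derivative
        (?z * (F v + B' v)) $ n) (at v within {0..1})" for n
      by (simp add: has_param_derivative_def)
    show ?thesis
      \<comment> \<open>The equation for \<open>F\<close> holds on the unit interval only, which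
        suffices for derivatives within that interval.\<close>
      unfolding has_param_derivative_def
      by (intro allI, rule has_vector_derivative_transform[OF that _ deriv])
        (rule arg_cong[OF F])
  qed
  have "has_param_derivative (\<lambda>v. F v * ?e v) (?z * (B' v * ?e v)) v" if "v \<in> {0..1}" for v
    using has_param_derivative_mult[OF F'[OF that] has_param_derivative_exp[of "- c" v]]
    by (simp add: algebra_simps fps_const_neg[symmetric] del: fps_const_neg)
  from param_integral_derivative[OF this x]
  have "?z * param_integral x (\<lambda>v. B' v * ?e v) = F x * ?e x - F 0"
    by (simp add: param_integral_fps_const_X)
  also have "param_integral x (\<lambda>v. B' v * ?e v) =
      param_integral x (\<lambda>v. param_deriv B v * fps_exp (- of_real v * c))"
    using x B by (intro param_integral_cong) (auto simp: param_deriv_eqI[OF B])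
  finally have "(F 0 + ?z * param_integral x (\<lambda>v. param_deriv B v * fps_exp (- of_real v * c)))
      * fps_exp (of_real x * c) = F x * (?e x * fps_exp (of_real x * c))"
    by (simp add: mult.assoc)
  then show ?thesis
    by (simp add: fps_exp_add_mult[symmetric])
qed

section \<open>Interpolation at the roots of unity\<close>

lemma zeta_power_root: "p \<ge> 1 \<Longrightarrow> (zeta p ^ j) ^ p = 1"
  by (subst power_mult[symmetric], subst mult.commute, subst power_mult)
     (simp add: zeta_def exp_of_nat_mult[symmetric])

lemma inj_on_zeta_power:
  assumes "p \<ge> 1"
  shows "inj_on (\<lambda>j. zeta p ^ j) {..<p}"
proof -
  have "zeta p ^ j = exp (2 * of_real pi * \<i> * of_nat j / of_nat p)" for j
    by (simp add: zeta_def exp_of_nat_mult[symmetric] mult_ac)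
  then show ?thesis
    using bij_betw_roots_unity[of p] assms by (simp add: bij_betw_def)
qed

text \<open>The linear factor accounts for one of the \<open>p + 1\<close> degrees of the
  product.\<close>

lemma degree_kernel_poly: "p \<ge> 1 \<Longrightarrow> degree (kernel_poly p j) \<le> p"
proof -
  assume p: "p \<ge> 1"
  have "degree (kernel_poly p j * [:- (zeta p ^ j), 1:]) \<le> p + 1"
    unfolding kernel_poly_mult[OF p]
    by (intro degree_diff_le) (auto intro: order.trans[OF degree_monom_le])
  then show ?thesis
    by (cases "kernel_poly p j = 0") (simp_all add: degree_mult_eq del: mult_pCons_right)
qed

lemma poly_kernel_poly_0:
  assumes "p \<ge> 1"
  shows "poly (kernel_poly p j) 0 = 0"
proof -
  have "poly (kernel_poly p j * [:- (zeta p ^ j), 1:]) 0 = 0"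
    unfolding kernel_poly_mult[OF assms] by (simp add: poly_monom)
  moreover have "zeta p ^ j \<noteq> 0"
    by (simp add: zeta_def)
  ultimately show ?thesis by (auto simp del: mult_pCons_right)
qed

text \<open>Up to the factor \<open>p\<close> these are Lagrange basis polynomials at the roots of
  unity. The diagonal value is the derivative of \<open>t^(p+1) - t\<close> at a root, namely
  \<open>(p + 1) - 1 = p\<close>.\<close>

lemma poly_kernel_poly_zeta:
  assumes "i < p" "j < p"
  shows "poly (kernel_poly p j) (zeta p ^ i) = (if i = j then of_nat p else 0)"
proof (cases "i = j")
  case True
  let ?c = "zeta p ^ j"
  have "poly (pderiv (kernel_poly p j * [:- ?c, 1:])) ?c = poly (kernel_poly p j) ?c"
    by (simp add: pderiv_mult pderiv_pCons del: mult_pCons_right)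
  moreover have "poly (pderiv (kernel_poly p j * [:- ?c, 1:])) ?c = of_nat p"
    using assms kernel_poly_mult[of p j] zeta_power_root[of p j]
    by (simp add: pderiv_diff pderiv_monom poly_monom del: mult_pCons_right)
  ultimately show ?thesis
    using True by simp
next
  case False
  have "poly (kernel_poly p j * [:- (zeta p ^ j), 1:]) (zeta p ^ i) = 0"
    using assms kernel_poly_mult[of p j] zeta_power_root[of p i] by (simp add: poly_monom del: mult_pCons_right)
  moreover have "zeta p ^ i \<noteq> zeta p ^ j"
    using inj_on_zeta_power[of p] assms False by (auto dest: inj_onD)
  ultimately show ?thesis
    using False by (simp del: mult_pCons_right)
qed

text \<open>Both sides have degree at most \<open>p\<close> and agree at \<open>p + 1\<close>
  distinct points, namely 0 and the \<open>p\<close>-th roots of unity.\<close>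

lemma interpolation_roots_of_unity:
  assumes "p \<ge> 1" "degree P \<le> p" "poly P 0 = 0"
  shows "P = (\<Sum>j=0..p - 1. smult (1 / of_nat p) (kernel_poly p j) * [:poly P (zeta p ^ j):])"
    (is "P = ?Q")
proof (rule poly_eqI_degree)
  let ?A = "insert 0 ((\<lambda>j. zeta p ^ j) ` {..<p})"
  have "0 \<notin> (\<lambda>j. zeta p ^ j) ` {..<p}"
    by (auto simp: zeta_def)
  then have card: "card ?A = Suc p"
    using inj_on_zeta_power[OF assms(1)] by (simp add: card_image)
  show "degree P < card ?A"
    using assms card by simp
  have "degree ?Q \<le> p"
    using degree_kernel_poly[OF assms(1)]
    by (intro degree_sum_le) (auto intro: order.trans[OF degree_smult_le])
  then show "degree ?Q < card ?A"
    using card by simp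
  have atLeast0: "{0..p - 1} = {..<p}"
    using assms(1) by auto
  show "poly P t = poly ?Q t" if t: "t \<in> ?A" for t
  proof (cases "t = 0")
    case True
    then show ?thesis
      using assms by (simp add: poly_sum poly_kernel_poly_0)
  next
    case False
    then obtain i where i: "i < p" "t = zeta p ^ i"
      using t by blast
    have "poly ?Q t = (\<Sum>j<p. if j = i then poly P (zeta p ^ j) else 0)"
      unfolding poly_sum atLeast0
      by (intro sum.cong refl) (use i in \<open>auto simp: poly_kernel_poly_zeta\<close>)
    then show ?thesis
      using i by simp
  qed
qed

section \<open>The generating function\<close>

lemma fps_nth_R_gf:
  assumes "\<And>n k. R_prob M D n p k x = player_prob n p k x"
  shows "R_gf M D p x $ n = (\<Sum>k=1..p. monom (of_real (player_prob n p k x)) k)"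
  by (simp add: R_gf_def R_player_def fps_const_poly_def fps_sum_nth assms smult_monom)

lemma fps_eval_R_gf:
  assumes "\<And>n k. R_prob M D n p k x = player_prob n p k x"
  shows "fps_eval_poly (R_gf M D p x) t = Abs_fps (\<lambda>n. player_gf n p t x)"
  by (rule fps_ext)
     (simp add: fps_eval_poly_def fps_nth_R_gf[OF assms] poly_sum poly_monom player_gf_def)

text \<open>The hypothesis \<open>t ^ p = 1\<close> kills the correction term in
  \<open>player_gf_Suc\<close>, which leaves exactly the linear integral equation solved
  above.\<close>

lemma R_tilde_root_of_unity:
  assumes R: "\<And>n p k x. R_prob M D n p k x = player_prob n p k x"
    and p: "p \<ge> 2" and t: "t ^ p = 1" and x: "x \<in> {0..1}"
  shows "R_tilde M D p x t = fps_eval_poly (R_gf M D p x) t"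
proof -
  let ?F = "\<lambda>p v. fps_eval_poly (R_gf M D p v) t"
  let ?B = "\<lambda>v. fps_const (of_real (1 - v)) * ?F (p - 1) v"
  have eval: "?F q v $ n = player_gf n q t v" for q v n
    by (simp add: fps_eval_R_gf R)
  have eq: "?F p v = fps_const t * fps_X * (param_integral v (?F p) + ?B v)"
    if v: "v \<in> {0..1}" for v
  proof (rule fps_ext)
    fix n
    show "?F p v $ n = (fps_const t * fps_X * (param_integral v (?F p) + ?B v)) $ n"
    proof (cases n)
      \<comment> \<open>The right side has the factor \<open>z\<close>; on the left, two or more
        players cannot finish in zero throws.\<close>
      case 0
      then show ?thesis
        using p by (simp add: eval player_gf_0)
    next
      case (Suc m)
      then show ?thesis
        using player_gf_Suc[OF p v, of m t] t
        by (simp add: eval mult.assoc param_integral_def)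
    qed
  qed
  have B': "has_param_derivative ?B (param_deriv ?B v) v" if v: "v \<in> {0..1}" for v
  proof -
    have "(\<lambda>u. of_real (1 - u) * player_gf n (p - 1) t u) differentiable (at v within {0..1})" for n
    proof -
      have "(\<lambda>u. complex_of_real (1 - u)) differentiable (at v within {0..1})"
        unfolding differentiable_def
        by (intro exI has_derivative_of_real) (rule derivative_intros)+
      then show ?thesis
        by (intro differentiable_mult player_gf_differentiable v)
    qed
    then show ?thesis
      by (simp add: has_param_derivative_def param_deriv_def eval vector_derivative_works[symmetric])
  qed
  \<comment> \<open>The initial value is \<open>t^p z^(p-1)\<close>, and
    \<open>t ^ p = 1\<close>.\<close>
  have "?F p 0 = fps_X ^ (p - 1)"
  proof (rule fps_ext)
    fix n
    have "Suc n = p \<longleftrightarrow> n = p - 1"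
      using p by auto
    then show "?F p 0 $ n = fps_X ^ (p - 1) $ n"
      using p t by (simp add: eval player_gf_at_0 fps_X_power_nth)
  qed
  moreover have "continuous_on {0..1} (\<lambda>v. ?F p v $ n)" for n
    unfolding eval using continuous_on_player_gf[of n p t] by simp
  ultimately show ?thesis
    unfolding R_tilde_def using param_integral_equation_solution[OF eq _ B' x] by simp
qed

theorem theorem4p4:
  fixes M :: "'a measure" and D :: "nat \<Rightarrow> 'a \<Rightarrow> real" and x :: real
  assumes "prob_space M"
    and "prob_space.indep_vars M (\<lambda>_. borel) D UNIV"
    and "\<And>i. distr M borel (D i) = uniform_measure lborel {0..1}"
    and "0 \<le> x" and "x \<le> 1"
  shows "R_gf M D 1 x = fps_const [:0, 1:] \<and>
    (\<forall>p\<ge>2. R_gf M D p x =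
       (\<Sum>j=0..p - 1. fps_const (smult (1 / of_nat p) (kernel_poly p j))
          * fps_const_poly (R_tilde M D p x (zeta p ^ j))))"
proof (intro conjI allI impI)
  have R: "R_prob M D n p k y = player_prob n p k y" for n p k y
    unfolding player_prob_def by (rule R_prob_eq_win_prob[OF assms(1-3)])
  show "R_gf M D 1 x = fps_const [:0, 1:]"
  proof (rule fps_ext)
    fix n
    show "R_gf M D 1 x $ n = fps_const [:0, 1:] $ n"
      by (cases n)
         (simp_all add: fps_nth_R_gf[OF R, simplified] player_prob_def win_prob_0 win_prob_Suc_game_over monom_altdef)
  qed
  fix p :: nat
  assume p: "p \<ge> 2"
  show "R_gf M D p x = (\<Sum>j=0..p - 1. fps_const (smult (1 / of_nat p) (kernel_poly p j))
          * fps_const_poly (R_tilde M D p x (zeta p ^ j)))"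
  proof (rule fps_ext)
    fix n
    let ?P = "R_gf M D p x $ n"
    have "degree ?P \<le> p"
      unfolding fps_nth_R_gf[OF R] by (intro degree_sum_le) (auto intro: order.trans[OF degree_monom_le])
    \<comment> \<open>Positions start at 1, so there is no constant term in
      \<open>t\<close>.\<close>
    moreover have "poly ?P 0 = 0"
      unfolding fps_nth_R_gf[OF R] by (auto simp: poly_sum poly_monom)
    ultimately have "?P = (\<Sum>j=0..p - 1. smult (1 / of_nat p) (kernel_poly p j) * [:poly ?P (zeta p ^ j):])"
      using p by (intro interpolation_roots_of_unity) auto
    also have "\<dots> = (\<Sum>j=0..p - 1. fps_const (smult (1 / of_nat p) (kernel_poly p j))
          * fps_const_poly (R_tilde M D p x (zeta p ^ j))) $ n"
      using assms(4,5) p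
      by (simp add: fps_sum_nth fps_const_poly_def R_tilde_root_of_unity[OF R p] zeta_power_root fps_eval_poly_def)
    finally show "?P = (\<Sum>j=0..p - 1. fps_const (smult (1 / of_nat p) (kernel_poly p j))
          * fps_const_poly (R_tilde M D p x (zeta p ^ j))) $ n" .
  qed
qed

end
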